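(* Let $\gamma_0=\frac{\sqrt5-1}{2}$. There is an absolute constant $C>0$ such that for every $\varepsilon>0$, every positive integer $N$, and every trigonometric polynomial $f$ with frequencies in the set $\{n^2: n\in\mathbb{Z},\ N\leq n\leq N+N^{\gamma_0-\varepsilon}\}$, we have $$\|f\|_4\leq C\,\varepsilon^{-1/4}\|f\|_2 .$$
   Context: A trigonometric polynomial $f$ has frequencies in a finite set $A\subseteq\mathbb{Z}$ if $f(x)=\sum_{n\in A}a_ne(nx)$ with $a_n\in\mathbb{C}$, where $e(x)=e^{2\pi i x}$. For $p\geq 1$, $\|f\|_p=\left(\int_{\mathbb{T}}|f(x)|^p\,dx\right)^{1/p}$ with $\mathbb{T}=\mathbb{R}/\mathbb{Z}$.
   Formalization: The formal statement requires 0 < ε ≤ 1; for unbounded ε the claim is false, since f(x)=e(N²x) has both norms equal to 1 and would force 1 ≤ Cε^{-1/4} for all ε > 0. *)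

theory Defs
  imports "HOL-Analysis.Analysis"
begin

definition e :: "real \<Rightarrow> complex" where
  "e x = exp (2 * of_real pi * \<i> * of_real x)"

text \<open>Functions on the torus are represented by functions on the reals; those considered
  here are 1-periodic, since the frequencies are integers.\<close>

definition trig_poly_with_freqs :: "int set \<Rightarrow> (real \<Rightarrow> complex) \<Rightarrow> bool" where
  "trig_poly_with_freqs A f \<longleftrightarrow>
     finite A \<and> (\<exists>a :: int \<Rightarrow> complex. \<forall>x. f x = (\<Sum>n\<in>A. a n * e (of_int n * x)))"

text \<open>The norm of \<open>L\<^sup>p\<close> of the torus, with the unit interval as fundamental domain;
  meant for \<open>p \<ge> 1\<close>.\<close>

definition torus_norm :: "real \<Rightarrow> (real \<Rightarrow> complex) \<Rightarrow> real" where
  "torus_norm p f = (LINT x:{0..1}|lborel. norm (f x) powr p) powr (1 / p)"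

definition \<gamma>\<^sub>0 :: real where
  "\<gamma>\<^sub>0 = (sqrt 5 - 1) / 2"

definition short_squares :: "nat \<Rightarrow> real \<Rightarrow> int set" where
  "short_squares N \<epsilon> =
     {n\<^sup>2 | n :: int. real N \<le> of_int n \<and> of_int n \<le> real N + real N powr (\<gamma>\<^sub>0 - \<epsilon>)}"

lemma finite_short_squares: "finite (short_squares N \<epsilon>)"
proof (rule finite_subset)
  show "short_squares N \<epsilon> \<subseteq>
      power2 ` {int N..\<lfloor>real N + real N powr (\<gamma>\<^sub>0 - \<epsilon>)\<rfloor>}"
  proof
    fix m assume "m \<in> short_squares N \<epsilon>"
    then obtain n where n: "m = n\<^sup>2" "real N \<le> of_int n"
        "of_int n \<le> real N + real N powr (\<gamma>\<^sub>0 - \<epsilon>)"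
      unfolding short_squares_def by blast
    have "n \<in> {int N..\<lfloor>real N + real N powr (\<gamma>\<^sub>0 - \<epsilon>)\<rfloor>}"
      using n(2) n(3)[folded le_floor_iff] by simp
    then show "m \<in> power2 ` {int N..\<lfloor>real N + real N powr (\<gamma>\<^sub>0 - \<epsilon>)\<rfloor>}"
      using n(1) by blast
  qed
qed simp

end

theory Submission
  imports Defs "HOL-Number_Theory.Prime_Powers"
begin

text \<open>Expanding the fourth power turns the claim into a weighted count of the solutions of
  $a^2+b^2=c^2+d^2$ in $[N,N+M]$ with $M=N^{\gamma_0-\varepsilon}$. A nontrivial solution gives the
  factorizations $(a-c)(a+c)=(d-b)(d+b)$ and $(a-d)(a+d)=(c-b)(c+b)$. The two gcds
  $\gcd(a+c,b+d)$ and $\gcd(a+d,b+c)$ have product at most $16\delta N$, where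
  $\delta=\gcd(a,b,c,d)$, so in one of the two factorizations, called good, the divisors
  $t=a+c$ and $t'=b+d$ of $m=a^2-c^2$ are far apart for the metric
  $\mathrm{dist}(t,t')=\log(tt'/\gcd(t,t')^2)$. By a Schur test it suffices to bound, for a fixed
  pair $(a,c)$, the number $k$ of good partners.

  Two distinct divisors of $m$ in a short interval are also far apart for dist, since their gcd is at
  most their difference. On the other hand dist is a sum of cut metrics over the prime powers
  dividing $m$, of total mass $\log m$, so for weights $c_i$ of total $T$ one has
  $\sum c_ic_j\,\mathrm{dist}(t_i,t_j)\le\frac12T^2\log m$. Give the partners weight $1$ and
  $t$ the weight $sk$. At $s=2\gamma_0-1$ the resulting inequality balances
  exactly when $M=N^{\gamma_0}$, and the loss of the diagonal terms yields $k=O(1/\varepsilon)$.\<close>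

section \<open>A gcd bound for equal sums of two squares\<close>

text \<open>With \<open>t\<close> the first gcd, the equation gives
  \<open>a + c = \<beta> * t\<close>, \<open>b + d = \<alpha> * t\<close>,
  \<open>a - c = g * \<alpha>\<close>, \<open>d - b = g * \<beta>\<close>. Then
  \<open>2 * (a + d)\<close> and \<open>2 * (b + c)\<close> share the factor
  \<open>\<alpha> + \<beta>\<close>, and \<open>(\<alpha> + \<beta>) * t\<close> is the sum of all
  four variables; what remains of the second gcd is at most \<open>gcd t g\<close>, which divides
  \<open>2 * \<delta>\<close>.\<close>

lemma gcd_mult_gcd_le:
  fixes a b c d :: int
  assumes pos: "a > 0" "b > 0" "c > 0" "d > 0"
    and eq: "a\<^sup>2 + b\<^sup>2 = c\<^sup>2 + d\<^sup>2"
  shows "gcd (a + c) (b + d) * gcd (a + d) (b + c) \<le> 2 * gcd (gcd a b) (gcd c d) * (a + b + c + d)"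
proof -
  define t where "t = gcd (a + c) (b + d)"
  define \<delta> where "\<delta> = gcd (gcd a b) (gcd c d)"
  have t0: "t > 0" using pos by (simp add: t_def gcd_pos_int)
  obtain \<beta> \<alpha> where ab: "a + c = \<beta> * t" "b + d = \<alpha> * t" "coprime \<beta> \<alpha>"
    using gcd_coprime_exists[of "a + c" "b + d"] t0 unfolding t_def by auto
  have \<alpha>0: "\<alpha> > 0" and \<beta>0: "\<beta> > 0"
    using ab t0 pos by (metis add_pos_pos zero_less_mult_pos2)+
  have "(a - c) * (a + c) = (d - b) * (b + d)"
    using eq by (simp add: power2_eq_square algebra_simps)
  then have "(a - c) * \<beta> = (d - b) * \<alpha>"
    using ab t0 by (simp add: mult.assoc[symmetric])
  then have "\<alpha> dvd a - c"
    using ab(3) by (metis coprime_commute coprime_dvd_mult_left_iff dvd_triv_right)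
  then obtain g where g: "a - c = g * \<alpha>" by (auto simp: dvd_def mult.commute)
  with \<open>(a - c) * \<beta> = (d - b) * \<alpha>\<close> \<alpha>0 have g': "d - b = g * \<beta>"
    by (simp add: mult.assoc mult.left_commute[of _ \<alpha>] mult.commute[of _ \<alpha>])
  define h where "h = gcd t g"
  have h0: "h > 0" using t0 by (simp add: h_def gcd_pos_int)
  have \<delta>0: "\<delta> > 0" using pos by (simp add: \<delta>_def gcd_pos_int)
  have ad: "2 * (a + d) = (\<alpha> + \<beta>) * (t + g)" and bc: "2 * (b + c) = (\<alpha> + \<beta>) * (t - g)"
    using ab g g' by (auto simp: algebra_simps)
  have gcd2: "gcd (2 * x) (2 * y) = 2 * gcd x y" for x y :: int
    using gcd_mult_distrib_int[of 2 x y] by (simp only: abs_numeral)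
  have "2 * gcd (a + d) (b + c) = gcd (2 * (a + d)) (2 * (b + c))"
    by (simp only: gcd2)
  also have "\<dots> = (\<alpha> + \<beta>) * gcd (t + g) (t - g)"
    using \<alpha>0 \<beta>0 gcd_mult_distrib_int[of "\<alpha> + \<beta>" "t + g" "t - g"] unfolding ad bc by simp
  also have "\<dots> \<le> (\<alpha> + \<beta>) * (2 * h)"
  proof (rule mult_left_mono)
    have "gcd (t + g) (t - g) dvd (t + g) + (t - g)" "gcd (t + g) (t - g) dvd (t + g) - (t - g)"
      by (meson dvd_add dvd_diff gcd_dvd1 gcd_dvd2)+
    then have "gcd (t + g) (t - g) dvd gcd (2 * t) (2 * g)"
      by simp
    then show "gcd (t + g) (t - g) \<le> 2 * h"
      using h0 by (intro zdvd_imp_le) (auto simp: h_def gcd_mult_distrib_int[symmetric])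
  qed (use \<alpha>0 \<beta>0 in auto)
  finally have A: "gcd (a + d) (b + c) \<le> (\<alpha> + \<beta>) * h" by simp
  \<comment> \<open>Adding and subtracting the parametrization expresses each doubled variable
    through \<open>t\<close> and \<open>g\<close>, for instance
    \<open>2 * a = \<beta> * t + g * \<alpha>\<close>.\<close>
  have "h dvd t" "h dvd g" by (auto simp: h_def)
  then have "h dvd \<beta> * t + g * \<alpha>" "h dvd \<beta> * t - g * \<alpha>" "h dvd \<alpha> * t + g * \<beta>" "h dvd \<alpha> * t - g * \<beta>"
    by (meson dvd_add dvd_diff dvd_mult dvd_mult2)+
  then have "h dvd 2 * a" "h dvd 2 * c" "h dvd 2 * d" "h dvd 2 * b"
    unfolding ab(1,2)[symmetric] g[symmetric] g'[symmetric] by (simp_all add: algebra_simps)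
  then have "h dvd gcd (gcd (2 * a) (2 * b)) (gcd (2 * c) (2 * d))" by simp
  also have "\<dots> = 2 * \<delta>" by (simp only: gcd2 \<delta>_def)
  finally have "h \<le> 2 * \<delta>" using \<delta>0 by (intro zdvd_imp_le) auto
  then have "(\<alpha> + \<beta>) * h \<le> (\<alpha> + \<beta>) * (2 * \<delta>)"
    using \<alpha>0 \<beta>0 by (intro mult_left_mono) auto
  with A have "t * gcd (a + d) (b + c) \<le> t * ((\<alpha> + \<beta>) * (2 * \<delta>))"
    using t0 by (intro mult_left_mono) auto
  also have "\<dots> = 2 * \<delta> * (a + c + (b + d))"
    unfolding ab by (simp add: algebra_simps)
  finally show ?thesis by (simp add: t_def \<delta>_def algebra_simps)
qed

section \<open>The metric on divisors\<close>

text \<open>This is $\log(ab/\gcd(a,b)^2)$, the $\ell^1$-distance of the valuation vectors with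
  weight $\log p$ at the prime $p$.\<close>

definition gcd_dist :: "nat \<Rightarrow> nat \<Rightarrow> real" where
  "gcd_dist a b = ln (real a) + ln (real b) - 2 * ln (real (gcd a b))"

text \<open>Summing over the divisors of the fixed \<open>m\<close> instead of those of
  \<open>n\<close> lets the logarithms of several divisors of \<open>m\<close> be compared term by
  term.\<close>

lemma ln_eq_sum_mangoldt:
  assumes "m > 0" "n dvd m"
  shows "ln (real n) = (\<Sum>q | q dvd m. mangoldt q * of_bool (q dvd n))"
proof -
  have "n > 0" using assms by (auto intro: Nat.gr0I)
  then have "ln (real n) = (\<Sum>q | q dvd n. mangoldt q)"
    using mangoldt_sum[of n, where ?'a = real] by simp
  also have "\<dots> = (\<Sum>q | q dvd m. mangoldt q * of_bool (q dvd n))"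
    using assms by (intro sum.mono_neutral_cong_left) (auto dest: dvd_trans)
  finally show ?thesis .
qed

text \<open>Since \<open>q\<close> divides the gcd iff it divides both numbers, the coefficient of
  \<open>mangoldt q\<close> is 1 exactly when divisibility by \<open>q\<close> separates
  \<open>a\<close> from \<open>b\<close>.\<close>

lemma gcd_dist_eq_sum_mangoldt:
  assumes "m > 0" "a dvd m" "b dvd m"
  shows "gcd_dist a b = (\<Sum>q | q dvd m. mangoldt q *
    (of_bool (q dvd a) + of_bool (q dvd b) - 2 * of_bool (q dvd a) * of_bool (q dvd b)))"
proof -
  have "gcd a b dvd m" using assms by (meson dvd_trans gcd_dvd1)
  note L = ln_eq_sum_mangoldt[OF assms(1,2)] ln_eq_sum_mangoldt[OF assms(1,3)]
    ln_eq_sum_mangoldt[OF assms(1) this]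
  show ?thesis
    unfolding gcd_dist_def L
    by (auto simp: sum_distrib_left simp flip: sum.distrib sum_subtractf intro!: sum.cong)
qed

text \<open>Passing to the cofactor reflects the valuation vectors in that of \<open>m\<close>,
  which is an isometry. Concretely, \<open>gcd a' b' * (a * b) = m * gcd a b\<close>.\<close>

lemma gcd_dist_cofactors:
  assumes m: "m > 0" and "a * a' = m" "b * b' = m"
  shows "gcd_dist a' b' = gcd_dist a b"
proof -
  have pos: "a > 0" "a' > 0" "b > 0" "b' > 0" using assms by (auto intro!: Nat.gr0I)
  have "gcd a' b' * (a * b) = gcd (a' * a * b) (b' * b * a)"
    by (simp add: gcd_mult_distrib_nat mult_ac)
  also have "\<dots> = gcd (m * b) (m * a)"
    using assms by (metis mult.commute)
  also have "\<dots> = m * gcd a b"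
    by (simp add: gcd_mult_distrib_nat gcd.commute)
  finally have "ln (real (gcd a' b' * (a * b))) = ln (real (m * gcd a b))" by simp
  then have 1: "ln (real (gcd a' b')) + (ln a + ln b) = ln m + ln (real (gcd a b))"
    using pos m by (simp add: ln_mult)
  have "ln (real (a * a')) = ln a + ln a'" "ln (real (b * b')) = ln b + ln b'"
    using pos by (simp_all add: ln_mult)
  then have 2: "ln m = ln a + ln a'" "ln m = ln b + ln b'"
    using assms(2,3) by simp_all
  show ?thesis unfolding gcd_dist_def using 1 2 by linarith
qed

lemma primepow_dvd_mult_square:
  fixes q a b t d :: nat
  assumes "primepow q" "q dvd t" "q dvd d" "t * d = a * b"
  shows "q dvd a \<or> q dvd b"
proof -
  obtain p k where p: "prime p" "k > 0" "q = p ^ k"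
    using assms(1) by (auto simp: primepow_def)
  show ?thesis
  proof (cases "a = 0 \<or> b = 0")
    case False
    have "p ^ (2 * k) dvd a * b"
      using assms p by (metis mult_dvd_mono mult_2 power_add)
    then have "2 * k \<le> multiplicity p (a * b)"
      using False p by (intro multiplicity_geI) auto
    also have "\<dots> = multiplicity p a + multiplicity p b"
      using False p by (intro prime_elem_multiplicity_mult_distrib) auto
    finally have "k \<le> multiplicity p a \<or> k \<le> multiplicity p b" by linarith
    then show ?thesis using p by (auto intro: multiplicity_dvd')
  qed auto
qed

text \<open>The contribution of one prime power. Give each point of \<open>T\<close> mass 1 and the
  centre mass \<open>s * card T\<close>, in total W. A cut with mass U on one side separates ordered
  pairs of total weight 2U(W - U), at most W^2 / 2, and there are two cuts, \<open>x\<close> and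
  \<open>y\<close>. The last summand is the correction for a centre lying in both.\<close>

lemma star_cut_inequality:
  fixes x y :: "'a \<Rightarrow> bool" and s :: real
  assumes "finite T" "s \<ge> 0"
    and xy: "x0 \<Longrightarrow> y0 \<Longrightarrow> (\<And>a. a \<in> T \<Longrightarrow> x a \<or> y a)"
  defines "D \<equiv> \<lambda>u v. of_bool u + of_bool v - 2 * of_bool u * of_bool v :: real"
  shows "(\<Sum>a\<in>T. \<Sum>b\<in>T. D (x a) (x b)) + (\<Sum>a\<in>T. \<Sum>b\<in>T. D (y a) (y b))
      + 2 * s * card T * (\<Sum>a\<in>T. D x0 (x a) + D y0 (y a) + 2 * of_bool (x0 \<and> y0 \<and> x a \<and> y a))
      \<le> ((1 + s) * card T)\<^sup>2"
proof -
  define k where "k = real (card T)"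
  define X where "X = (\<Sum>a\<in>T. of_bool (x a) :: real)"
  define Y where "Y = (\<Sum>a\<in>T. of_bool (y a) :: real)"
  have DD: "(\<Sum>a\<in>T. \<Sum>b\<in>T. D (z a) (z b)) = 2 * k * (\<Sum>a\<in>T. of_bool (z a)) - 2 * (\<Sum>a\<in>T. of_bool (z a))\<^sup>2" for z
    unfolding D_def k_def
    by (simp add: sum.distrib sum_subtractf power2_eq_square mult.assoc
        flip: sum_distrib_left sum_distrib_right)
  have D0: "(\<Sum>a\<in>T. D u (z a)) = of_bool u * k + (\<Sum>a\<in>T. of_bool (z a)) - 2 * of_bool u * (\<Sum>a\<in>T. of_bool (z a))" for u z
    unfolding D_def k_def
    by (simp add: sum.distrib sum_subtractf flip: sum_distrib_left)
  have W: "(\<Sum>a\<in>T. of_bool (x0 \<and> y0 \<and> x a \<and> y a)) = of_bool (x0 \<and> y0) * (X + Y - k)"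
  proof (cases "x0 \<and> y0")
    case True
    then have "(\<Sum>a\<in>T. of_bool (x0 \<and> y0 \<and> x a \<and> y a)) = (\<Sum>a\<in>T. of_bool (x a) + of_bool (y a) - 1 :: real)"
      using xy by (intro sum.cong) auto
    then show ?thesis using True by (simp add: X_def Y_def k_def sum.distrib sum_subtractf)
  qed auto
  have sq: "((1 + s) * k)\<^sup>2 - 2 * ((1 + s) * k * (U + V)) + 2 * U\<^sup>2 + 2 * V\<^sup>2
      = 2 * (((1 + s) * k / 2 - U)\<^sup>2 + ((1 + s) * k / 2 - V)\<^sup>2)" for U V
    by (simp add: field_simps power2_eq_square)
  then have sq: "2 * ((1 + s) * k * (U + V)) - 2 * U\<^sup>2 - 2 * V\<^sup>2 \<le> ((1 + s) * k)\<^sup>2" for U V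
    by (smt (verit) zero_le_power2)
  \<comment> \<open>If \<open>x0\<close> and \<open>y0\<close> both hold, the correction makes the
    left side equal to its value when neither holds, so the square for \<open>X\<close> and
    \<open>Y\<close> serves both cases. In the mixed cases the cut containing the centre is
    described by its complement, hence \<open>k - X\<close> or \<open>k - Y\<close>.\<close>
  have "2 * k * X - 2 * X\<^sup>2 + (2 * k * Y - 2 * Y\<^sup>2)
      + 2 * s * k * ((of_bool x0 * k + X - 2 * of_bool x0 * X) + (of_bool y0 * k + Y - 2 * of_bool y0 * Y)
        + 2 * (of_bool (x0 \<and> y0) * (X + Y - k))) \<le> ((1 + s) * k)\<^sup>2"
    using sq[of X Y] sq[of "k - X" Y] sq[of X "k - Y"]
    by (cases x0; cases y0) (simp_all add: algebra_simps power2_eq_square)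
  then show ?thesis
    unfolding DD
    unfolding sum.distrib D0 sum_distrib_left[symmetric] W
    unfolding X_def Y_def k_def .
qed

text \<open>The logarithm of the gcd compensates for a common factor of the two factorizations
  $m=t\cdot(m/t)=a\cdot(m/a)$, which weakens the lower bound on the distance from \<open>t\<close> to \<open>a\<close>.
  It comes for free: a prime power dividing both \<open>t\<close> and \<open>m div t\<close> divides \<open>a\<close> or
  \<open>m div a\<close>.\<close>

lemma star_gcd_dist_le:
  fixes m t :: nat and T :: "nat set" and s :: real
  assumes m: "m > 0" and T: "finite T" "\<And>a. a \<in> T \<Longrightarrow> a dvd m" and t: "t dvd m" and s: "s \<ge> 0"
  shows "(\<Sum>a\<in>T. \<Sum>b\<in>T. gcd_dist a b)
      + 2 * s * card T * (\<Sum>a\<in>T. gcd_dist t a + ln (real (gcd (gcd t (m div t)) (gcd a (m div a)))))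
      \<le> ((1 + s) * card T)\<^sup>2 / 2 * ln m"
proof -
  define D :: "bool \<Rightarrow> bool \<Rightarrow> real" where "D u v = of_bool u + of_bool v - 2 * of_bool u * of_bool v" for u v
  define E where "E q a b = D (q dvd a) (q dvd b) + D (q dvd m div a) (q dvd m div b)" for q a b :: nat
  \<comment> \<open>The correction term concerns prime powers dividing a divisor and its cofactor at
    once, so each distance is written as half the sum over both families of cuts.\<close>
  have dist: "2 * gcd_dist a b = (\<Sum>q | q dvd m. mangoldt q * E q a b)" if "a dvd m" "b dvd m" for a b
  proof -
    have "gcd_dist (m div a) (m div b) = gcd_dist a b"
      using that m by (intro gcd_dist_cofactors[of m]) auto
    then have "2 * gcd_dist a b = gcd_dist a b + gcd_dist (m div a) (m div b)" by simp
    also have "\<dots> = (\<Sum>q | q dvd m. mangoldt q * E q a b)"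
      using that m by (subst (1 2) gcd_dist_eq_sum_mangoldt[of m])
        (auto simp: E_def D_def distrib_left simp flip: sum.distrib)
    finally show ?thesis .
  qed
  define B where "B q a \<longleftrightarrow> q dvd t \<and> q dvd m div t \<and> q dvd a \<and> q dvd m div a" for q a
  have h: "ln (real (gcd (gcd t (m div t)) (gcd a (m div a)))) = (\<Sum>q | q dvd m. mangoldt q * of_bool (B q a))"
    if "a dvd m" for a
    using that m t by (subst ln_eq_sum_mangoldt[of m]) (auto simp: B_def intro: dvd_trans)
  have "2 * ((\<Sum>a\<in>T. \<Sum>b\<in>T. gcd_dist a b)
      + 2 * s * card T * (\<Sum>a\<in>T. gcd_dist t a + ln (real (gcd (gcd t (m div t)) (gcd a (m div a))))))
    = (\<Sum>a\<in>T. \<Sum>b\<in>T. 2 * gcd_dist a b)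
      + 2 * s * card T * (\<Sum>a\<in>T. 2 * gcd_dist t a + 2 * ln (real (gcd (gcd t (m div t)) (gcd a (m div a)))))"
    by (simp add: sum_distrib_left algebra_simps)
  also have "\<dots> = (\<Sum>a\<in>T. \<Sum>b\<in>T. \<Sum>q | q dvd m. mangoldt q * E q a b)
      + 2 * s * card T * (\<Sum>a\<in>T. (\<Sum>q | q dvd m. mangoldt q * E q t a) + 2 * (\<Sum>q | q dvd m. mangoldt q * of_bool (B q a)))"
    using T t by (simp add: dist h)
  also have "\<dots> = (\<Sum>q | q dvd m. mangoldt q *
      ((\<Sum>a\<in>T. \<Sum>b\<in>T. E q a b) + 2 * s * card T * (\<Sum>a\<in>T. E q t a + 2 * of_bool (B q a))))"
    by (simp add: sum_distrib_left sum.distrib algebra_simps sum.swap[of _ "{q. q dvd m}" T])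
  also have "\<dots> \<le> (\<Sum>q | q dvd m. mangoldt q * ((1 + s) * card T)\<^sup>2)"
  proof (rule sum_mono)
    fix q assume "q \<in> {q. q dvd m}"
    show "mangoldt q * ((\<Sum>a\<in>T. \<Sum>b\<in>T. E q a b) + 2 * s * card T * (\<Sum>a\<in>T. E q t a + 2 * of_bool (B q a)))
      \<le> mangoldt q * ((1 + s) * card T)\<^sup>2"
    proof (cases "primepow q")
      case True
      have "q dvd a \<or> q dvd m div a" if "q dvd t" "q dvd m div t" "a \<in> T" for a
        using primepow_dvd_mult_square[OF True that(1,2)] t T(2)[OF that(3)] by simp
      from star_cut_inequality[of T s "q dvd t" "q dvd m div t" "\<lambda>a. q dvd a" "\<lambda>a. q dvd m div a", OF T(1) s this]
      have "(\<Sum>a\<in>T. \<Sum>b\<in>T. E q a b) + 2 * s * card T * (\<Sum>a\<in>T. E q t a + 2 * of_bool (B q a))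
          \<le> ((1 + s) * card T)\<^sup>2"
        unfolding E_def D_def B_def by (simp only: sum.distrib)
      then show ?thesis by (intro mult_left_mono) (auto simp: mangoldt_nonneg)
    qed (simp add: mangoldt_def)
  qed
  also have "\<dots> = ((1 + s) * card T)\<^sup>2 * ln m"
    using m mangoldt_sum[of m, where ?'a = real] by (simp flip: sum_distrib_right)
  finally show ?thesis by simp
qed

section \<open>Counting divisors in short intervals\<close>

text \<open>The quadratic equation produces the exact balance in the divisor count; the bounds
  ensure \<open>s \<ge> 0\<close> and \<open>1 - \<gamma>\<^sub>0 \<ge> 3 / 8\<close> there.\<close>

lemma golden_ratio_facts: "\<gamma>\<^sub>0\<^sup>2 = 1 - \<gamma>\<^sub>0" "\<gamma>\<^sub>0 \<ge> 1 / 2" "\<gamma>\<^sub>0 \<le> 5 / 8"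
proof -
  have "sqrt 5 \<ge> 2" by (rule real_le_rsqrt) simp
  moreover have "sqrt 5 \<le> 9 / 4" by (rule real_le_lsqrt) (simp_all add: power2_eq_square)
  moreover have "(sqrt 5)\<^sup>2 = 5" by simp
  ultimately show "\<gamma>\<^sub>0\<^sup>2 = 1 - \<gamma>\<^sub>0" "\<gamma>\<^sub>0 \<ge> 1 / 2" "\<gamma>\<^sub>0 \<le> 5 / 8"
    unfolding \<gamma>\<^sub>0_def by (auto simp: power2_eq_square field_simps)
qed

lemma gcd_dist_ge_of_close:
  fixes a b N :: nat and D :: real
  assumes "N > 0" "a \<noteq> b" "a \<ge> N" "b \<ge> N" "\<bar>real a - real b\<bar> \<le> D"
  shows "gcd_dist a b \<ge> 2 * ln (N / D)"
proof -
  have "gcd a b dvd nat \<bar>int a - int b\<bar>"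
    by (metis dvd_diff gcd_dvd1 gcd_dvd2 int_dvd_int_iff nat_dvd_iff dvd_nat_abs_iff)
  then have "gcd a b \<le> nat \<bar>int a - int b\<bar>"
    using assms by (intro dvd_imp_le) auto
  then have "real (gcd a b) \<le> \<bar>real a - real b\<bar>" by linarith
  then have gD: "real (gcd a b) \<le> D" using assms by linarith
  have g0: "gcd a b > 0" using assms by (auto intro: Nat.gr0I)
  with gD have "D > 0" by (smt (verit) of_nat_0_less_iff)
  have "ln (real (gcd a b)) \<le> ln D" using gD g0 by (intro ln_mono) auto
  moreover have "ln (real a) \<ge> ln (real N)" "ln (real b) \<ge> ln (real N)"
    using assms by (auto intro!: ln_mono)
  moreover have "ln (N / D) = ln (real N) - ln D" using \<open>D > 0\<close> assms by (simp add: ln_div)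
  ultimately show ?thesis unfolding gcd_dist_def by linarith
qed

text \<open>The upper bound of \<open>star_gcd_dist_le\<close> is played against two lower bounds:
  elements of \<open>T\<close> are far from each other because they are close as integers, and far
  from \<open>t\<close> by \<open>far\<close>. The terms of order \<open>card T ^ 2 * ln N\<close>
  without a factor \<open>\<epsilon>\<close> cancel, so the gain proportional to
  \<open>\<epsilon>\<close> has to be paid for by the missing diagonal pairs.\<close>

lemma card_close_divisors_le:
  fixes m t N :: nat and T :: "nat set" and M \<epsilon> :: real
  assumes N: "N > 0" and M: "M = real N powr (\<gamma>\<^sub>0 - \<epsilon>)" and \<epsilon>: "0 < \<epsilon>" "\<epsilon> \<le> 1"
    and m: "m > 0" "real m \<le> 4 * real N * M"
    and t: "t dvd m" and T: "finite T" "\<And>a. a \<in> T \<Longrightarrow> a dvd m" "\<And>a. a \<in> T \<Longrightarrow> a \<ge> 2 * N"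
    and close: "\<And>a b. a \<in> T \<Longrightarrow> b \<in> T \<Longrightarrow> \<bar>real a - real b\<bar> \<le> M / 2"
    and far: "\<And>a. a \<in> T \<Longrightarrow>
      ln (real N / 4) \<le> gcd_dist t a + ln (real (gcd (gcd t (m div t)) (gcd a (m div a))))"
  shows "real (card T) \<le> 4 / \<epsilon>"
proof (rule ccontr)
  assume "\<not> ?thesis"
  then have k: "real (card T) > 4 / \<epsilon>" by simp
  define k where "k = real (card T)"
  define L where "L = ln (real N)"
  \<comment> \<open>This value maximizes \<open>2 * (1 - \<gamma>\<^sub>0) + 2 * s - (1 + s)\<^sup>2
    / 2 * (1 + \<gamma>\<^sub>0)\<close>, the net coefficient of \<open>k\<^sup>2 * L\<close> at
    \<open>\<epsilon> = 0\<close>, and the maximum is 0.\<close>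
  define s where "s = 2 * \<gamma>\<^sub>0 - 1"
  note g0 = golden_ratio_facts
  have k4: "k > 4 / \<epsilon>" "4 / \<epsilon> \<ge> 4" using k \<epsilon> by (auto simp: k_def field_simps)
  then have k0: "k > 4" by linarith
  have L0: "L \<ge> 0" using N by (simp add: L_def)
  have M0: "M > 0" using N M by simp
  have lnM: "ln M = (\<gamma>\<^sub>0 - \<epsilon>) * L" using N by (simp add: M L_def ln_powr)
  have lnm: "ln m \<le> ln 4 + L + (\<gamma>\<^sub>0 - \<epsilon>) * L"
  proof -
    have "ln m \<le> ln (4 * real N * M)" using m by (intro ln_mono) auto
    also have "\<dots> = ln 4 + L + ln M" using N M0 by (simp add: ln_mult L_def)
    finally show ?thesis by (simp add: lnM)
  qed
  \<comment> \<open>This is \<open>2 * ln (4 * N / M)\<close>: the elements are at least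
    \<open>2 * N\<close> and differ by at most \<open>M / 2\<close>.\<close>
  define R where "R = 2 * (ln 4 + (1 - \<gamma>\<^sub>0 + \<epsilon>) * L)"
  have R: "gcd_dist a b \<ge> R * of_bool (a \<noteq> b)" if "a \<in> T" "b \<in> T" for a b
  proof (cases "a = b")
    case False
    have "gcd_dist a b \<ge> 2 * ln (real (2 * N) / (M / 2))"
      using False N T(3) close that by (intro gcd_dist_ge_of_close) auto
    also have "ln (real (2 * N) / (M / 2)) = ln (4 * real N / M)" by simp
    also have "\<dots> = ln 4 + L - ln M" using N M0 by (simp add: ln_div ln_mult L_def)
    finally show ?thesis using False by (simp add: R_def lnM algebra_simps)
  qed (simp add: gcd_dist_def)
  have "R * (k * (k - 1)) = (\<Sum>a\<in>T. \<Sum>b\<in>T. R * of_bool (a \<noteq> b))"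
  proof -
    have "(\<Sum>b\<in>T. R * of_bool (a \<noteq> b)) = R * (k - 1)" if "a \<in> T" for a
    proof -
      have "(\<Sum>b\<in>T. R * of_bool (a \<noteq> b)) = (\<Sum>b\<in>T. R - (if a = b then R else 0))"
        by (intro sum.cong) auto
      also have "\<dots> = R * (k - 1)"
        using that T(1) by (simp add: sum_subtractf k_def algebra_simps)
      finally show ?thesis .
    qed
    then show ?thesis by (simp add: k_def)
  qed
  also have "\<dots> \<le> (\<Sum>a\<in>T. \<Sum>b\<in>T. gcd_dist a b)" by (intro sum_mono R)
  finally have 1: "R * (k * (k - 1)) \<le> (\<Sum>a\<in>T. \<Sum>b\<in>T. gcd_dist a b)" .
  have "k * (L - ln 4) \<le> (\<Sum>a\<in>T. gcd_dist t a + ln (real (gcd (gcd t (m div t)) (gcd a (m div a)))))"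
    using sum_mono[OF far] N by (simp add: k_def L_def ln_div)
  then have 2: "2 * s * k * (k * (L - ln 4)) \<le> 2 * s * k * (\<Sum>a\<in>T. gcd_dist t a + ln (real (gcd (gcd t (m div t)) (gcd a (m div a)))))"
    using g0 k0 by (intro mult_left_mono) (auto simp: s_def)
  have "R * (k * (k - 1)) + 2 * s * k * (k * (L - ln 4)) \<le> ((1 + s) * k)\<^sup>2 / 2 * ln m"
    using 1 2 star_gcd_dist_le[OF m(1) T(1,2) t, of s] g0 by (simp add: s_def k_def)
  also have "\<dots> \<le> ((1 + s) * k)\<^sup>2 / 2 * (ln 4 + L + (\<gamma>\<^sub>0 - \<epsilon>) * L)"
    using lnm by (intro mult_left_mono) auto
  also have "((1 + s) * k)\<^sup>2 / 2 = k * (2 * (1 - \<gamma>\<^sub>0) * k)"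
    using g0(1) by (simp add: s_def power_mult_distrib) (simp add: power2_eq_square)
  finally have "k * (R * (k - 1) + 2 * s * k * (L - ln 4))
      \<le> k * (2 * (1 - \<gamma>\<^sub>0) * k * (ln 4 + L + (\<gamma>\<^sub>0 - \<epsilon>) * L))"
    by (simp add: algebra_simps)
  then have "R * (k - 1) + 2 * s * k * (L - ln 4) \<le> 2 * (1 - \<gamma>\<^sub>0) * k * (ln 4 + L + (\<gamma>\<^sub>0 - \<epsilon>) * L)"
    using k0 by simp
  \<comment> \<open>The bracket on the far right vanishes by the equation for
    \<open>\<gamma>\<^sub>0\<close>. The constants \<open>ln 4\<close> add up to a positive multiple
    of \<open>k\<close>, which settles the case of small \<open>L\<close>, and \<open>- R\<close> is
    the loss from the diagonal.\<close>
  moreover have "R * (k - 1) + 2 * s * k * (L - ln 4) - 2 * (1 - \<gamma>\<^sub>0) * k * (ln 4 + L + (\<gamma>\<^sub>0 - \<epsilon>) * L)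
      = k * ((1 - \<gamma>\<^sub>0) * (2 * ln 4)) + (2 * \<epsilon> + 2 * (1 - \<gamma>\<^sub>0) * \<epsilon>) * k * L - R
        + 2 * k * L * (\<gamma>\<^sub>0\<^sup>2 - (1 - \<gamma>\<^sub>0))"
    unfolding R_def s_def by (simp add: algebra_simps power2_eq_square)
  ultimately have main: "k * ((1 - \<gamma>\<^sub>0) * (2 * ln 4)) + (2 * \<epsilon> + 2 * (1 - \<gamma>\<^sub>0) * \<epsilon>) * k * L \<le> R"
    using g0(1) by simp
  have ln4: "ln 4 > (0 :: real)" by simp
  have "4 * (3 / 8 * (2 * ln 4)) \<le> k * ((1 - \<gamma>\<^sub>0) * (2 * ln 4))"
    using k0 g0 ln4 by (intro mult_mono) auto
  then have A: "3 * ln 4 \<le> k * ((1 - \<gamma>\<^sub>0) * (2 * ln 4))" by linarith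
  have B: "8 * L \<le> (2 * \<epsilon> + 2 * (1 - \<gamma>\<^sub>0) * \<epsilon>) * k * L"
  proof -
    have "8 \<le> 2 * \<epsilon> * k" using k4 \<epsilon> by (simp add: field_simps)
    also have "\<dots> \<le> (2 * \<epsilon> + 2 * (1 - \<gamma>\<^sub>0) * \<epsilon>) * k"
      using k0 \<epsilon> g0 by (intro mult_right_mono) auto
    finally show ?thesis using L0 by (intro mult_right_mono)
  qed
  from add_mono[OF A B] main have "3 * ln 4 + 8 * L \<le> R" by (rule order_trans)
  moreover have "(1 - \<gamma>\<^sub>0 + \<epsilon>) * L \<le> 2 * L" using L0 g0 \<epsilon> by (intro mult_right_mono) auto
  then have "R \<le> 2 * ln 4 + 4 * L" unfolding R_def by argo
  ultimately show False using ln4 L0 by linarith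
qed

text \<open>The condition depends on the matching of \<open>a\<close> with \<open>c\<close> and of \<open>b\<close> with \<open>d\<close>; the other
  matching is \<open>good N a b d c\<close>.\<close>

definition good :: "nat \<Rightarrow> nat \<Rightarrow> nat \<Rightarrow> nat \<Rightarrow> nat \<Rightarrow> bool" where
  "good N a b c d \<longleftrightarrow>
     ln (real N / 4) \<le> gcd_dist (a + c) (b + d) + ln (real (gcd (gcd a b) (gcd c d)))"

text \<open>All four sums are at least \<open>2 * N\<close>, and the two gcds multiply to at most
  \<open>16 * \<delta> * N\<close>. Hence the two corrected distances add up to at least
  \<open>2 * ln (N / 4)\<close>, and one of them reaches half of that.\<close>

lemma good_or_good:
  fixes a b c d N :: nat
  assumes N: "N > 0" and I: "{a, b, c, d} \<subseteq> {N..2 * N}" and eq: "a\<^sup>2 + b\<^sup>2 = c\<^sup>2 + d\<^sup>2"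
  shows "good N a b c d \<or> good N a b d c"
proof -
  define \<delta> where "\<delta> = gcd (gcd a b) (gcd c d)"
  define t where "t = gcd (a + c) (b + d)"
  define t' where "t' = gcd (a + d) (b + c)"
  have pos: "\<delta> > 0" "t > 0" "t' > 0" using I N by (auto simp: \<delta>_def t_def t'_def gcd_pos_nat)
  have "int t * int t' \<le> 2 * int \<delta> * (int a + int b + int c + int d)"
    unfolding \<delta>_def t_def t'_def of_nat_add gcd_int_int_eq[symmetric]
    using I N arg_cong[OF eq, of int] by (intro gcd_mult_gcd_le) auto
  then have "t * t' \<le> 2 * \<delta> * (a + b + c + d)"
    by (metis of_nat_add of_nat_le_iff of_nat_mult of_nat_numeral)
  also have "\<dots> \<le> 2 * \<delta> * (8 * N)" using I by (intro mult_left_mono) auto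
  finally have "ln (real (t * t')) \<le> ln (real (2 * \<delta> * (8 * N)))"
    using pos by (intro ln_mono) (auto simp del: of_nat_mult)
  also have "real (2 * \<delta> * (8 * N)) = 2 ^ 4 * real \<delta> * real N" by simp
  finally have tt: "ln t + ln t' \<le> 4 * ln 2 + ln \<delta> + ln N"
    using pos N by (simp add: ln_mult ln_realpow del: power_numeral)
  have ge: "ln (real (x + y)) \<ge> ln 2 + ln N" if "x \<ge> N" "y \<ge> N" for x y
  proof -
    have "ln (2 * real N) \<le> ln (real (x + y))" using that N by (intro ln_mono) auto
    then show ?thesis using N by (simp add: ln_mult)
  qed
  have "ln (4::real) = 2 * ln 2" using ln_realpow[of "2::real" 2] by simp
  then have "ln (real N / 4) = ln N - 2 * ln 2" using N by (simp add: ln_div)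
  moreover have "gcd_dist (a + c) (b + d) + gcd_dist (a + d) (b + c)
      \<ge> 4 * (ln 2 + ln N) - 2 * (ln t + ln t')"
    using ge[of a c] ge[of b d] ge[of a d] ge[of b c] I unfolding gcd_dist_def t_def t'_def by simp
  ultimately have "ln (real N / 4) \<le> gcd_dist (a + c) (b + d) + ln (real \<delta>) \<or>
      ln (real N / 4) \<le> gcd_dist (a + d) (b + c) + ln (real \<delta>)"
    using tt by argo
  then show ?thesis unfolding good_def gcd.commute[of d c] \<delta>_def[symmetric] .
qed

text \<open>The first symmetry makes the kernel of the Schur test symmetric; the second reduces
  \<open>a < c\<close> to \<open>a > c\<close>.\<close>

lemma good_sym:
  "good N b a d c \<longleftrightarrow> good N a b c d" "good N c d a b \<longleftrightarrow> good N a b c d"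
proof -
  show "good N b a d c \<longleftrightarrow> good N a b c d"
    unfolding good_def gcd_dist_def gcd.commute[of b a] gcd.commute[of d c] gcd.commute[of "b + d"]
    by (simp only: add.commute)
  show "good N c d a b \<longleftrightarrow> good N a b c d"
    unfolding good_def add.commute[of c a] add.commute[of d b] gcd.commute[of "gcd c d"] ..
qed

text \<open>A partner \<open>(b, d)\<close> is determined by the divisor \<open>b + d\<close> of
  \<open>m\<close>, its cofactor being \<open>d - b\<close>. These divisors fall into five classes
  of diameter at most \<open>M / 2\<close>, each with at most \<open>4 / \<epsilon>\<close>
  elements.\<close>

lemma card_partners_le_of_gt:
  fixes N a c :: nat and M \<epsilon> :: real
  assumes N: "N > 0" and M: "M = real N powr (\<gamma>\<^sub>0 - \<epsilon>)" and \<epsilon>: "0 < \<epsilon>" "\<epsilon> \<le> 1"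
  defines "A \<equiv> {n. N \<le> n \<and> real n \<le> real N + M}"
  assumes ac: "a \<in> A" "c \<in> A" "a > c"
  shows "real (card {(b, d) \<in> A \<times> A. a\<^sup>2 + b\<^sup>2 = c\<^sup>2 + d\<^sup>2 \<and> good N a b c d}) \<le> 20 / \<epsilon>"
proof -
  define S where "S = {(b, d) \<in> A \<times> A. a\<^sup>2 + b\<^sup>2 = c\<^sup>2 + d\<^sup>2 \<and> good N a b c d}"
  define m where "m = (a - c) * (a + c)"
  define T where "T = (\<lambda>(b, d). b + d) ` S"
  have M0: "M > 0" using N M by simp
  have MN: "M \<le> N" unfolding M
    using N \<epsilon> golden_ratio_facts powr_mono[of "\<gamma>\<^sub>0 - \<epsilon>" 1 "real N"] by simp
  have m0: "m > 0" using ac by (simp add: m_def)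
  have rm: "real m = (real a - real c) * (real a + real c)" using ac by (simp add: m_def of_nat_diff)
  have "real m \<le> M * (4 * N)"
    unfolding rm using ac M0 MN by (intro mult_mono) (auto simp: A_def)
  then have m3: "real m \<le> 4 * real N * M" by (simp add: mult_ac)
  have S: "d > b" "m = (d - b) * (b + d)" if "(b, d) \<in> S" for b d
  proof -
    have eq: "a\<^sup>2 + b\<^sup>2 = c\<^sup>2 + d\<^sup>2" using that by (simp add: S_def)
    moreover have "c\<^sup>2 < a\<^sup>2" using ac by (simp add: power_strict_mono)
    ultimately have "b\<^sup>2 < d\<^sup>2" by linarith
    then show "d > b" by (rule power_less_imp_less_base) simp
    obtain u v where "a = c + u" "d = b + v"
      using \<open>d > b\<close> ac(3) by (metis less_imp_add_positive)
    with eq show "m = (d - b) * (b + d)"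
      by (simp add: m_def power2_eq_square algebra_simps)
  qed
  have inj: "inj_on (\<lambda>(b, d). b + d) S"
  proof (rule inj_onI, clarify)
    fix b d b' d' assume *: "(b, d) \<in> S" "(b', d') \<in> S" "b + d = b' + d'"
    have eq: "(d - b) * (b + d) = (d' - b') * (b + d)" 
      using trans[OF S(2)[OF *(1), symmetric] S(2)[OF *(2)]] unfolding *(3)[symmetric] .
    have "b + d \<noteq> 0" using S(1)[OF *(1)] by simp
    from iffD1[OF mult_right_cancel[OF this] eq] have "d - b = d' - b'" .
    then show "b = b' \<and> d = d'" using S(1)[OF *(1)] S(1)[OF *(2)] *(3) by linarith
  qed
  have finA: "finite A"
    by (rule finite_subset[of _ "{..2 * N}"]) (use MN in \<open>auto simp: A_def\<close>)
  have finT: "finite T" unfolding T_def S_def by (intro finite_imageI finite_subset[OF _ finite_cartesian_product[OF finA finA]]) auto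
  \<comment> \<open>Cutting into intervals of length \<open>M / 2\<close> gains a factor 4 in the gcds, which pays for all
    constants lost elsewhere; otherwise the count would not be \<open>O(1 / \<epsilon>)\<close> for \<open>\<epsilon>\<close> below \<open>1 / ln N\<close>.\<close>
  define cl where "cl t = \<lfloor>(real t - 2 * N) * 2 / M\<rfloor>" for t :: nat
  \<comment> \<open>The sums lie between \<open>2 * N\<close> and \<open>2 * N + 2 * M\<close>; the
    index 4 occurs only at the right endpoint.\<close>
  have range: "cl ` T \<subseteq> {0..4}"
  proof clarify
    fix t assume "t \<in> T"
    then have "real t \<ge> 2 * N" "real t \<le> 2 * N + 2 * M" by (auto simp: T_def S_def A_def)
    then have "0 \<le> (real t - 2 * N) * 2 / M" "(real t - 2 * N) * 2 / M \<le> 4"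
      using M0 by (auto simp: field_simps)
    then show "cl t \<in> {0..4}" unfolding cl_def by (auto simp: floor_le_iff)
  qed
  have "real (card {t \<in> T. cl t = j}) \<le> 4 / \<epsilon>" for j
  proof (rule card_close_divisors_le[OF N M \<epsilon> m0 m3, of "a + c"])
    show "a + c dvd m" by (simp add: m_def)
    show "finite {t \<in> T. cl t = j}" using finT by simp
  next
    fix x y assume "x \<in> {t \<in> T. cl t = j}" "y \<in> {t \<in> T. cl t = j}"
    then have "\<bar>(real x - 2 * N) * 2 / M - (real y - 2 * N) * 2 / M\<bar> < 1" unfolding cl_def by simp linarith
    also have "(real x - 2 * N) * 2 / M - (real y - 2 * N) * 2 / M = (real x - real y) * 2 / M"
      unfolding diff_divide_distrib[symmetric] by (simp add: algebra_simps)
    finally have "\<bar>(real x - real y) * 2\<bar> < M" using M0 by (simp add: divide_less_eq)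
    then show "\<bar>real x - real y\<bar> \<le> M / 2" unfolding abs_mult by simp
  next
    fix t assume "t \<in> {t \<in> T. cl t = j}"
    then obtain b d where bd: "(b, d) \<in> S" "t = b + d" by (auto simp: T_def)
    show "t dvd m" using S(2)[OF bd(1)] bd(2) by simp
    show "2 * N \<le> t" using bd by (auto simp: S_def A_def)
    have t0: "t > 0" using S(1)[OF bd(1)] bd(2) by simp
    have "m div t = d - b" unfolding S(2)[OF bd(1)] bd(2) using t0 bd(2) by simp
    moreover have "m div (a + c) = a - c" using ac by (simp add: m_def)
    ultimately have div: "m div t = d - b" "m div (a + c) = a - c" .
    \<comment> \<open>\<open>\<delta>\<close> divides both divisors and both cofactors, so the
      correction in \<open>good\<close> is at most the one required by the divisor count.\<close>
    define \<delta> where "\<delta> = gcd (gcd a b) (gcd c d)"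
    have "\<delta> dvd a" "\<delta> dvd b" "\<delta> dvd c" "\<delta> dvd d" by (auto simp: \<delta>_def intro: dvd_trans)
    then have "\<delta> dvd gcd (gcd (a + c) (a - c)) (gcd t (d - b))"
      by (simp add: bd(2) dvd_diff_nat)
    then have "\<delta> \<le> gcd (gcd (a + c) (a - c)) (gcd t (d - b))"
      using t0 by (intro dvd_imp_le) auto
    moreover have "\<delta> > 0" using ac by (simp add: \<delta>_def)
    ultimately have "ln (real \<delta>) \<le> ln (real (gcd (gcd (a + c) (a - c)) (gcd t (d - b))))"
      by (intro ln_mono) auto
    moreover have "good N a b c d" using bd by (simp add: S_def)
    ultimately show "ln (real N / 4) \<le> gcd_dist (a + c) t
        + ln (real (gcd (gcd (a + c) (m div (a + c))) (gcd t (m div t))))"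
      unfolding good_def \<delta>_def[symmetric] div bd(2)[symmetric] by linarith
  qed
  then have "(\<Sum>j\<in>{0..4::int}. real (card {t \<in> T. cl t = j})) \<le> (\<Sum>j\<in>{0..4::int}. 4 / \<epsilon>)"
    by (intro sum_mono)
  moreover have "(\<Sum>j\<in>{0..4::int}. card {t \<in> T. cl t = j}) = card T"
    using sum.group[OF finT finite_atLeastAtMost_int range, of "\<lambda>_. 1::nat"] by simp
  moreover have "card T = card S" unfolding T_def by (rule card_image[OF inj])
  ultimately show ?thesis unfolding S_def[symmetric] by (simp flip: of_nat_sum)
qed

section \<open>The additive energy\<close>

text \<open>The Schur test: replace \<open>v p * v q\<close> by the mean of the two squares; by
  symmetry both halves are sums of \<open>(v p)\<^sup>2\<close> weighted by row sums.\<close>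

lemma symmetric_kernel_sum_le:
  fixes g :: "'a \<Rightarrow> 'a \<Rightarrow> real" and v :: "'a \<Rightarrow> real"
  assumes nonneg: "\<And>p q. g p q \<ge> 0"
    and sym: "\<And>p q. g p q = g q p"
    and row: "\<And>p. p \<in> S \<Longrightarrow> (\<Sum>q\<in>S. g p q) \<le> K"
  shows "(\<Sum>p\<in>S. \<Sum>q\<in>S. g p q * (v p * v q)) \<le> K * (\<Sum>p\<in>S. (v p)\<^sup>2)"
proof -
  have "(\<Sum>p\<in>S. \<Sum>q\<in>S. g p q * (v p * v q)) \<le> (\<Sum>p\<in>S. \<Sum>q\<in>S. g p q * (((v p)\<^sup>2 + (v q)\<^sup>2) / 2))"
  proof (intro sum_mono mult_left_mono nonneg)
    show "v p * v q \<le> ((v p)\<^sup>2 + (v q)\<^sup>2) / 2" for p q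
      using sum_squares_bound[of "v p" "v q"] by (simp add: field_simps)
  qed
  also have "\<dots> = (\<Sum>p\<in>S. \<Sum>q\<in>S. g p q * (v p)\<^sup>2) / 2 + (\<Sum>p\<in>S. \<Sum>q\<in>S. g p q * (v q)\<^sup>2) / 2"
    by (simp add: sum.distrib sum_divide_distrib algebra_simps add_divide_distrib)
  also have "(\<Sum>p\<in>S. \<Sum>q\<in>S. g p q * (v q)\<^sup>2) = (\<Sum>p\<in>S. \<Sum>q\<in>S. g p q * (v p)\<^sup>2)"
    by (subst sum.swap) (simp add: sym)
  also have "(\<Sum>p\<in>S. \<Sum>q\<in>S. g p q * (v p)\<^sup>2) = (\<Sum>p\<in>S. (\<Sum>q\<in>S. g p q) * (v p)\<^sup>2)"
    by (simp add: sum_distrib_right)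
  also have "\<dots> / 2 + \<dots> / 2 = \<dots>" by simp
  also have "\<dots> \<le> (\<Sum>p\<in>S. K * (v p)\<^sup>2)" by (intro sum_mono mult_right_mono row) auto
  also have "\<dots> = K * (\<Sum>p\<in>S. (v p)\<^sup>2)" by (simp add: sum_distrib_left)
  finally show ?thesis .
qed

lemma sum_product_pairs_square:
  fixes w :: "'a \<Rightarrow> real"
  shows "(\<Sum>(a, b)\<in>A \<times> A. (w a * w b)\<^sup>2) = (\<Sum>a\<in>A. (w a)\<^sup>2)\<^sup>2"
proof -
  have "(\<Sum>(a, b)\<in>A \<times> A. (w a * w b)\<^sup>2) = (\<Sum>a\<in>A. \<Sum>b\<in>A. (w a)\<^sup>2 * (w b)\<^sup>2)"
    by (simp add: sum.cartesian_product power_mult_distrib)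
  also have "\<dots> = (\<Sum>a\<in>A. (w a)\<^sup>2)\<^sup>2"
    by (simp add: sum_product power2_eq_square[of "sum _ _"])
  finally show ?thesis .
qed

lemma card_partners_le:
  fixes N a c :: nat and M \<epsilon> :: real
  assumes N: "N > 0" and M: "M = real N powr (\<gamma>\<^sub>0 - \<epsilon>)" and \<epsilon>: "0 < \<epsilon>" "\<epsilon> \<le> 1"
  defines "A \<equiv> {n. N \<le> n \<and> real n \<le> real N + M}"
  assumes ac: "a \<in> A" "c \<in> A" "a \<noteq> c"
  shows "real (card {(b, d) \<in> A \<times> A. a\<^sup>2 + b\<^sup>2 = c\<^sup>2 + d\<^sup>2 \<and> good N a b c d}) \<le> 20 / \<epsilon>"
proof (cases "a > c")
  case True
  then show ?thesis by (rule card_partners_le_of_gt[OF N M \<epsilon>, folded A_def, OF ac(1,2)])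
next
  case False
  then have "c > a" using ac by simp
  let ?S = "{(b, d) \<in> A \<times> A. a\<^sup>2 + b\<^sup>2 = c\<^sup>2 + d\<^sup>2 \<and> good N a b c d}"
  let ?S' = "{(d, b) \<in> A \<times> A. c\<^sup>2 + d\<^sup>2 = a\<^sup>2 + b\<^sup>2 \<and> good N c d a b}"
  have "?S = prod.swap ` ?S'"
    by (force simp: good_sym(2))
  then have "card ?S = card ?S'"
    by (simp only: card_image[OF inj_on_subset[OF inj_swap subset_UNIV]])
  moreover have "real (card ?S') \<le> 20 / \<epsilon>"
    by (rule card_partners_le_of_gt[OF N M \<epsilon>, folded A_def, OF ac(2,1) \<open>c > a\<close>])
  ultimately show ?thesis by (simp only:)
qed

text \<open>Each solution is one of the two trivial ones or good in one of the two matchings. The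
  trivial ones contribute \<open>Q\<close> each and the matchings \<open>20 / \<epsilon> * Q\<close>
  each; \<open>\<epsilon> \<le> 1\<close> merges this into 42.\<close>

lemma energy_le:
  fixes N :: nat and M \<epsilon> :: real and w :: "nat \<Rightarrow> real"
  assumes N: "N > 0" and M: "M = real N powr (\<gamma>\<^sub>0 - \<epsilon>)" and \<epsilon>: "0 < \<epsilon>" "\<epsilon> \<le> 1"
    and w: "\<And>n. w n \<ge> 0"
  defines "A \<equiv> {n. N \<le> n \<and> real n \<le> real N + M}"
  shows "(\<Sum>a\<in>A. \<Sum>b\<in>A. \<Sum>c\<in>A. \<Sum>d\<in>A. of_bool (a\<^sup>2 + b\<^sup>2 = c\<^sup>2 + d\<^sup>2) * (w a * w b * (w c * w d)))
      \<le> 42 / \<epsilon> * (\<Sum>a\<in>A. (w a)\<^sup>2)\<^sup>2"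
proof -
  define W where "W a b c d = w a * w b * (w c * w d)" for a b c d
  \<comment> \<open>Rows with \<open>a = c\<close> are left out: there every \<open>b = d\<close>
    solves the equation, and the partner count covers only \<open>a \<noteq> c\<close>.\<close>
  define G where "G a b c d = of_bool (a\<^sup>2 + b\<^sup>2 = c\<^sup>2 + d\<^sup>2 \<and> a \<noteq> c \<and> good N a b c d) * W a b c d" for a b c d
  define Q where "Q = (\<Sum>a\<in>A. (w a)\<^sup>2)\<^sup>2"
  have MN: "M \<le> N" unfolding M
    using N \<epsilon> golden_ratio_facts powr_mono[of "\<gamma>\<^sub>0 - \<epsilon>" 1 "real N"] by simp
  have A2: "A \<subseteq> {N..2 * N}" unfolding A_def using MN by auto
  then have finA: "finite A" by (rule finite_subset) simp
  have W0: "W a b c d \<ge> 0" for a b c d using w by (simp add: W_def)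
  have G0: "G a b c d \<ge> 0" for a b c d using W0 by (simp add: G_def)
  have Q: "Q = (\<Sum>a\<in>A. \<Sum>b\<in>A. (w a * w b)\<^sup>2)"
    by (simp add: Q_def sum.cartesian_product flip: sum_product_pairs_square)
  have delta: "(\<Sum>c\<in>A. of_bool (c = a) * F c) = F a" if "a \<in> A" for a and F :: "nat \<Rightarrow> real"
  proof -
    have "(\<Sum>c\<in>A. of_bool (c = a) * F c) = (\<Sum>c\<in>A. if c = a then F c else 0)"
      by (intro sum.cong) auto
    then show ?thesis using that finA by simp
  qed
  have D: "(\<Sum>a\<in>A. \<Sum>b\<in>A. \<Sum>c\<in>A. \<Sum>d\<in>A. of_bool (c = a) * (of_bool (d = b) * W a b c d)) = (\<Sum>a\<in>A. \<Sum>b\<in>A. W a b a b)"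
    "(\<Sum>a\<in>A. \<Sum>b\<in>A. \<Sum>c\<in>A. \<Sum>d\<in>A. of_bool (c = b) * (of_bool (d = a) * W a b c d)) = (\<Sum>a\<in>A. \<Sum>b\<in>A. W a b b a)"
    by (intro sum.cong refl; simp add: delta flip: sum_distrib_left)+
  have "(\<Sum>a\<in>A. \<Sum>b\<in>A. \<Sum>c\<in>A. \<Sum>d\<in>A. of_bool (a\<^sup>2 + b\<^sup>2 = c\<^sup>2 + d\<^sup>2) * W a b c d)
     \<le> (\<Sum>a\<in>A. \<Sum>b\<in>A. \<Sum>c\<in>A. \<Sum>d\<in>A.
        of_bool (c = a) * (of_bool (d = b) * W a b c d) + of_bool (c = b) * (of_bool (d = a) * W a b c d)
        + G a b c d + G a b d c)"
  proof (intro sum_mono)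
    fix a b c d
    define T1 where "T1 = of_bool (c = a) * (of_bool (d = b) * W a b c d)"
    define T2 where "T2 = of_bool (c = b) * (of_bool (d = a) * W a b c d)"
    have T0: "T1 \<ge> 0" "T2 \<ge> 0" using W0 by (simp_all add: T1_def T2_def)
    assume I: "a \<in> A" "b \<in> A" "c \<in> A" "d \<in> A"
    show "of_bool (a\<^sup>2 + b\<^sup>2 = c\<^sup>2 + d\<^sup>2) * W a b c d
      \<le> of_bool (c = a) * (of_bool (d = b) * W a b c d) + of_bool (c = b) * (of_bool (d = a) * W a b c d)
        + G a b c d + G a b d c"
    proof (cases "a\<^sup>2 + b\<^sup>2 = c\<^sup>2 + d\<^sup>2")
      case True
      have comm: "W a b d c = W a b c d" by (simp add: W_def)
      have "good N a b c d \<or> good N a b d c"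
        using good_or_good[OF N _ True] I A2 by blast
      moreover have "d = b" if "c = a" using True that by (simp add: power2_eq_iff_nonneg)
      moreover have "c = b" if "d = a" using True that by (simp add: power2_eq_iff_nonneg)
      ultimately consider "c = a" "d = b" | "c = b" "d = a" | "c \<noteq> a" "good N a b c d" | "d \<noteq> a" "good N a b d c"
        by blast
      then have "T1 = W a b c d \<or> T2 = W a b c d \<or> G a b c d = W a b c d \<or> G a b d c = W a b c d"
      proof cases
        case 3
        then show ?thesis using True by (simp add: G_def)
      next
        case 4
        then show ?thesis using True comm by (simp add: G_def add.commute[of "d\<^sup>2"])
      qed (simp_all add: T1_def T2_def)
      then show ?thesis
        using T0 G0[of a b c d] G0[of a b d c] True unfolding T1_def[symmetric] T2_def[symmetric] by auto
    next
      case False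
      then show ?thesis
        using T0 G0[of a b c d] G0[of a b d c] unfolding T1_def[symmetric] T2_def[symmetric] by simp
    qed
  qed
  also have "\<dots> = (\<Sum>a\<in>A. \<Sum>b\<in>A. W a b a b) + (\<Sum>a\<in>A. \<Sum>b\<in>A. W a b b a)
      + (\<Sum>a\<in>A. \<Sum>b\<in>A. \<Sum>c\<in>A. \<Sum>d\<in>A. G a b c d) + (\<Sum>a\<in>A. \<Sum>b\<in>A. \<Sum>c\<in>A. \<Sum>d\<in>A. G a b d c)"
    unfolding sum.distrib D ..
  also have "(\<Sum>a\<in>A. \<Sum>b\<in>A. \<Sum>c\<in>A. \<Sum>d\<in>A. G a b d c) = (\<Sum>a\<in>A. \<Sum>b\<in>A. \<Sum>c\<in>A. \<Sum>d\<in>A. G a b c d)"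
    by (intro sum.cong refl sum.swap)
  also have "(\<Sum>a\<in>A. \<Sum>b\<in>A. W a b a b) = Q"
    unfolding Q by (intro sum.cong refl) (simp add: W_def power2_eq_square)
  also have "(\<Sum>a\<in>A. \<Sum>b\<in>A. W a b b a) = Q"
    unfolding Q by (intro sum.cong refl) (simp add: W_def power2_eq_square)
  also have "(\<Sum>a\<in>A. \<Sum>b\<in>A. \<Sum>c\<in>A. \<Sum>d\<in>A. G a b c d) \<le> 20 / \<epsilon> * Q"
  proof -
    define g :: "nat \<times> nat \<Rightarrow> nat \<times> nat \<Rightarrow> real" where
      "g = (\<lambda>(a, c) (b, d). of_bool (a\<^sup>2 + b\<^sup>2 = c\<^sup>2 + d\<^sup>2 \<and> a \<noteq> c \<and> good N a b c d))"
    define v where "v = (\<lambda>(a, c). w a * w c)"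
    \<comment> \<open>The kernel acts between the pairs \<open>(a, c)\<close> and
      \<open>(b, d)\<close>, taken from opposite sides of the equation.\<close>
    have "(\<Sum>a\<in>A. \<Sum>b\<in>A. \<Sum>c\<in>A. \<Sum>d\<in>A. G a b c d) = (\<Sum>a\<in>A. \<Sum>c\<in>A. \<Sum>b\<in>A. \<Sum>d\<in>A. G a b c d)"
      by (intro sum.cong refl sum.swap)
    also have "\<dots> = (\<Sum>(a, c)\<in>A \<times> A. \<Sum>(b, d)\<in>A \<times> A. G a b c d)"
      by (simp only: sum.cartesian_product[symmetric])
    also have "\<dots> = (\<Sum>p\<in>A \<times> A. \<Sum>q\<in>A \<times> A. g p q * (v p * v q))"
      by (simp add: G_def W_def g_def v_def split_def mult_ac)
    also have "\<dots> \<le> 20 / \<epsilon> * (\<Sum>p\<in>A \<times> A. (v p)\<^sup>2)"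
    proof (rule symmetric_kernel_sum_le)
      show "g p q \<ge> 0" for p q by (simp add: g_def split: prod.split)
      show "g p q = g q p" for p q
      proof (cases p; cases q)
        fix a c b d assume pq: "p = (a, c)" "q = (b, d)"
        have "a = c \<longleftrightarrow> b = d" if "a\<^sup>2 + b\<^sup>2 = c\<^sup>2 + d\<^sup>2"
          using that by (auto simp: power2_eq_iff_nonneg)
        then show ?thesis by (auto simp: pq g_def good_sym add.commute)
      qed
      show "(\<Sum>q\<in>A \<times> A. g p q) \<le> 20 / \<epsilon>" if "p \<in> A \<times> A" for p
      proof -
        obtain a c where p: "p = (a, c)" by (cases p)
        show ?thesis
        proof (cases "a = c")
          case True
          then show ?thesis using \<epsilon> by (simp add: g_def p split_def)
        next
          case False
          have "(\<Sum>q\<in>A \<times> A. g p q) = real (card {(b, d) \<in> A \<times> A. a\<^sup>2 + b\<^sup>2 = c\<^sup>2 + d\<^sup>2 \<and> good N a b c d})"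
            using False finA by (simp add: g_def p split_def Int_def mem_Times_iff conj_ac)
          also have "\<dots> \<le> 20 / \<epsilon>"
            using that False by (intro card_partners_le[OF N M \<epsilon>, folded A_def]) (auto simp: p)
          finally show ?thesis .
        qed
      qed
    qed
    also have "(\<Sum>p\<in>A \<times> A. (v p)\<^sup>2) = Q"
      unfolding Q_def sum_product_pairs_square[symmetric] by (simp add: v_def split_def)
    finally show ?thesis .
  qed
  finally have "(\<Sum>a\<in>A. \<Sum>b\<in>A. \<Sum>c\<in>A. \<Sum>d\<in>A. of_bool (a\<^sup>2 + b\<^sup>2 = c\<^sup>2 + d\<^sup>2) * W a b c d)
      \<le> 2 * Q + 40 / \<epsilon> * Q" by simp
  also have "2 * Q \<le> 2 / \<epsilon> * Q"
    using \<epsilon> by (intro mult_right_mono) (auto simp: Q_def field_simps)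
  finally show ?thesis unfolding W_def Q_def by (simp add: field_simps)
qed

section \<open>Trigonometric sums\<close>

lemma e_add: "e (x + y) = e x * e y"
  by (simp add: e_def distrib_left exp_add)

lemma cnj_e: "cnj (e x) = e (- x)"
  by (simp add: e_def exp_cnj)

lemma continuous_on_e: "continuous_on S (\<lambda>x. e (k * x))"
  unfolding e_def by (intro continuous_intros)

lemma e_int: "e (of_int k) = 1"
  using exp_integer_2pi[of "of_int k"] by (simp add: e_def mult_ac)

lemma integral_e:
  fixes k :: int
  shows "(LINT x:{0..1}|lborel. e (of_int k * x)) = of_bool (k = 0)"
proof (cases "k = 0")
  case True
  then show ?thesis by (simp add: e_def set_lebesgue_integral_def)
next
  case False
  define c where "c = 2 * of_real pi * \<i> * of_int k"
  have c: "c \<noteq> 0" using False by (simp add: c_def)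
  have e: "e (of_int k * x) = exp (of_real x * c)" for x by (simp add: e_def c_def mult_ac)
  have "(LINT x:{0..1}|lborel. e (of_int k * x)) = exp (of_real 1 * c) / c - exp (of_real 0 * c) / c"
    unfolding set_lebesgue_integral_def
  proof (rule integral_FTC_atLeastAtMost)
    show "((\<lambda>x. exp (of_real x * c) / c) has_vector_derivative e (of_int k * x)) (at x within {0..1})" for x
    proof -
      have "((\<lambda>z. exp (z * c) / c) has_field_derivative exp (of_real x * c)) (at (of_real x))"
        using c by (auto intro!: derivative_eq_intros)
      from has_vector_derivative_real_field[OF this] show ?thesis unfolding e
        by (rule has_vector_derivative_at_within)
    qed
  qed (auto intro: continuous_on_e)
  also have "\<dots> = (e (of_int k) - 1) / c" using e[of 1] by (simp add: diff_divide_distrib)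
  finally show ?thesis using False by (simp add: e_int)
qed

text \<open>Parseval with repeated frequencies allowed, since the square of the polynomial is
  indexed by pairs, many of which may share a frequency.\<close>

lemma integral_norm_square_trig_sum:
  fixes c :: "'a \<Rightarrow> complex" and \<nu> :: "'a \<Rightarrow> int"
  assumes "finite I"
  shows "of_real (LINT x:{0..1}|lborel. (norm (\<Sum>i\<in>I. c i * e (of_int (\<nu> i) * x)))\<^sup>2)
    = (\<Sum>i\<in>I. \<Sum>j\<in>I. of_bool (\<nu> i = \<nu> j) * (c i * cnj (c j)))"
proof -
  have sq: "of_real ((norm (\<Sum>i\<in>I. c i * e (of_int (\<nu> i) * x)))\<^sup>2)
      = (\<Sum>i\<in>I. \<Sum>j\<in>I. c i * cnj (c j) * e (of_int (\<nu> i - \<nu> j) * x))" for x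
  proof -
    have "e (of_int (\<nu> i - \<nu> j) * x) = e (of_int (\<nu> i) * x) * cnj (e (of_int (\<nu> j) * x))" for i j
      unfolding cnj_e e_add[symmetric] by (simp add: algebra_simps)
    then show ?thesis
      unfolding complex_norm_square cnj_sum sum_product by (simp add: mult_ac)
  qed
  have int: "set_integrable lborel {0..1} (\<lambda>x. a * e (of_int k * x))" for a k
    by (intro set_integrable_mult_right borel_integrable_atLeastAtMost' continuous_on_e)
  have "of_real (LINT x:{0..1}|lborel. (norm (\<Sum>i\<in>I. c i * e (of_int (\<nu> i) * x)))\<^sup>2)
     = (LINT x:{0..1}|lborel. of_real ((norm (\<Sum>i\<in>I. c i * e (of_int (\<nu> i) * x)))\<^sup>2) :: complex)"
    by (rule set_integral_complex_of_real[symmetric])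
  also have "\<dots> = (\<Sum>i\<in>I. \<Sum>j\<in>I. LINT x:{0..1}|lborel. c i * cnj (c j) * e (of_int (\<nu> i - \<nu> j) * x))"
    unfolding sq set_lebesgue_integral_def scaleR_sum_right
    using int by (simp add: set_integrable_def del: of_int_diff)
  also have "\<dots> = (\<Sum>i\<in>I. \<Sum>j\<in>I. of_bool (\<nu> i = \<nu> j) * (c i * cnj (c j)))"
    unfolding set_integral_mult_right integral_e by (simp add: mult.commute)
  finally show ?thesis .
qed

text \<open>The fourth power of the 4-norm is the integral of
  \<open>(norm ((f x)\<^sup>2))\<^sup>2\<close>, to which Parseval and then \<open>energy_le\<close>
  apply. Some upper bound on \<open>\<epsilon>\<close> is unavoidable: a single exponential has all
  norms equal, while \<open>\<epsilon> powr (-1/4)\<close> tends to 0.\<close>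

theorem theorem1p4:
  shows "\<exists>C::real. C > 0 \<and>
    (\<forall>(\<epsilon>::real) (N::nat) (f :: real \<Rightarrow> complex).
       0 < \<epsilon> \<longrightarrow> \<epsilon> \<le> 1 \<longrightarrow> 0 < N \<longrightarrow>
       trig_poly_with_freqs (short_squares N \<epsilon>) f \<longrightarrow>
       torus_norm 4 f \<le> C * \<epsilon> powr (-1/4) * torus_norm 2 f)"
proof (intro exI[of _ "42 powr (1/4)"] conjI allI impI)
  show "(42::real) powr (1/4) > 0" by simp
next
  fix \<epsilon> :: real and N :: nat and f :: "real \<Rightarrow> complex"
  assume \<epsilon>: "0 < \<epsilon>" "\<epsilon> \<le> 1" and N: "0 < N" and "trig_poly_with_freqs (short_squares N \<epsilon>) f"
  then obtain a where a: "\<And>x. f x = (\<Sum>n\<in>short_squares N \<epsilon>. a n * e (of_int n * x))"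
    unfolding trig_poly_with_freqs_def by blast
  define M where "M = real N powr (\<gamma>\<^sub>0 - \<epsilon>)"
  define A where "A = {n. N \<le> n \<and> real n \<le> real N + M}"
  define sq where "sq n = (int n)\<^sup>2" for n
  define z where "z n = a (sq n)" for n
  define S where "S = (\<Sum>n\<in>A. (norm (z n))\<^sup>2)"
  have sq_inj: "inj sq" unfolding sq_def by (auto simp: inj_def power2_eq_iff_nonneg)
  \<comment> \<open>Since \<open>n \<ge> N\<close> excludes negative \<open>n\<close>, the
    frequencies can be indexed by natural numbers, on which squaring is injective.\<close>
  have ss: "short_squares N \<epsilon> = sq ` A"
  proof
    show "short_squares N \<epsilon> \<subseteq> sq ` A"
    proof
      fix k assume "k \<in> short_squares N \<epsilon>"
      then obtain n :: int where n: "k = n\<^sup>2" "real N \<le> of_int n" "of_int n \<le> real N + M"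
        unfolding short_squares_def M_def by blast
      then have "n \<ge> 0" by linarith
      then obtain m where "n = int m" using nonneg_int_cases by blast
      with n show "k \<in> sq ` A" by (auto simp: sq_def A_def)
    qed
    show "sq ` A \<subseteq> short_squares N \<epsilon>"
      by (force simp: short_squares_def sq_def A_def M_def)
  qed
  have finA: "finite A"
    using finite_short_squares[of N \<epsilon>] finite_imageD[OF _ inj_on_subset[OF sq_inj subset_UNIV]]
    unfolding ss by blast
  have f: "f x = (\<Sum>n\<in>A. z n * e (of_int (sq n) * x))" for x
    unfolding a ss z_def by (subst sum.reindex) (auto intro: inj_on_subset[OF sq_inj])
  have "complex_of_real (LINT x:{0..1}|lborel. (norm (f x))\<^sup>2)
      = (\<Sum>i\<in>A. \<Sum>j\<in>A. of_bool (sq i = sq j) * (z i * cnj (z j)))"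
    unfolding f by (rule integral_norm_square_trig_sum[OF finA])
  also have "\<dots> = (\<Sum>i\<in>A. \<Sum>j\<in>A. if i = j then z i * cnj (z j) else 0)"
    by (intro sum.cong refl) (auto dest: injD[OF sq_inj])
  also have "\<dots> = of_real S"
    unfolding S_def of_real_sum complex_norm_square using finA by simp
  finally have I2: "(LINT x:{0..1}|lborel. (norm (f x))\<^sup>2) = S" by (simp only: of_real_eq_iff)
  define zz where "zz = (\<lambda>(i, j). z i * z j)"
  define sqs where "sqs = (\<lambda>(i, j). sq i + sq j)"
  have ff: "(f x)\<^sup>2 = (\<Sum>p\<in>A \<times> A. zz p * e (of_int (sqs p) * x))" for x
    by (simp add: f power2_eq_square[of "sum _ _"] sum_product sum.cartesian_product zz_def sqs_def
        split_def distrib_left distrib_right e_add mult_ac)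
  define I4 where "I4 = (LINT x:{0..1}|lborel. (norm ((f x)\<^sup>2))\<^sup>2)"
  \<comment> \<open>The expansion is an identity of complex numbers, so passing to the norm allows
    the coefficients to be replaced by their absolute values term by term.\<close>
  have "I4 \<le> norm (complex_of_real I4)" by simp
  also have "complex_of_real I4
      = (\<Sum>p\<in>A \<times> A. \<Sum>q\<in>A \<times> A. of_bool (sqs p = sqs q) * (zz p * cnj (zz q)))"
    unfolding I4_def ff by (rule integral_norm_square_trig_sum) (use finA in simp)
  also have "norm \<dots> \<le> (\<Sum>p\<in>A \<times> A. \<Sum>q\<in>A \<times> A. of_bool (sqs p = sqs q) * (norm (zz p) * norm (zz q)))"
    by (intro sum_norm_le) (simp add: norm_mult of_bool_def)
  also have "\<dots> = (\<Sum>(i, j)\<in>A \<times> A. \<Sum>(k, l)\<in>A \<times> A. of_bool (i\<^sup>2 + j\<^sup>2 = k\<^sup>2 + l\<^sup>2)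
      * (norm (z i) * norm (z j) * (norm (z k) * norm (z l))))"
    by (simp add: sqs_def sq_def zz_def norm_mult split_def flip: of_nat_power of_nat_add)
  also have "\<dots> = (\<Sum>i\<in>A. \<Sum>j\<in>A. \<Sum>k\<in>A. \<Sum>l\<in>A. of_bool (i\<^sup>2 + j\<^sup>2 = k\<^sup>2 + l\<^sup>2)
      * (norm (z i) * norm (z j) * (norm (z k) * norm (z l))))"
    by (simp only: sum.cartesian_product[symmetric])
  also have "\<dots> \<le> 42 / \<epsilon> * S\<^sup>2"
    unfolding S_def A_def by (rule energy_le[OF N M_def \<epsilon>]) simp
  finally have I4: "I4 \<le> 42 / \<epsilon> * S\<^sup>2" .
  have S0: "S \<ge> 0" by (simp add: S_def sum_nonneg)
  have I40: "I4 \<ge> 0" unfolding I4_def set_lebesgue_integral_def by (rule Bochner_Integration.integral_nonneg) simp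
  have "torus_norm 4 f = I4 powr (1/4)"
    by (simp add: torus_norm_def I4_def norm_power flip: power_mult)
  also have "\<dots> \<le> (42 / \<epsilon> * S\<^sup>2) powr (1/4)"
    using I4 I40 by (intro powr_mono2) auto
  also have "\<dots> = 42 powr (1/4) * \<epsilon> powr (-1/4) * S\<^sup>2 powr (1/4)"
    using \<epsilon> S0 by (simp add: powr_mult powr_divide powr_minus_divide)
  also have "S\<^sup>2 powr (1/4) = S powr (1/2)"
    using S0 powr_powr[of S 2 "1/4"] by simp
  also have "\<dots> = torus_norm 2 f"
    using I2 by (simp add: torus_norm_def)
  finally show "torus_norm 4 f \<le> 42 powr (1/4) * \<epsilon> powr (-1/4) * torus_norm 2 f" .
qed

end
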